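(* Let $(V,\|\cdot\|)$ be a Minkowski $3$-space with unit ball $C$. Suppose that $C$ does not intersect any two-plane in an ellipse, i.e. there is no two-dimensional affine plane $P\subset V$ such that $P\cap C$ is an ellipse. Then the group $\mathcal{I}(3)$ of isometries of $(V,\|\cdot\|)$ is isomorphic to the semi-direct product of the translation group $\mathcal{T}(3)$ of $\mathbb{R}^3$ with a finite subgroup of the group of linear transformations of $\mathbb{R}^3$ with determinant $\pm 1$.
   Context: A Minkowski $n$-space is a real normed space of finite dimension $n$. Its underlying vector space is identified with $\mathbb{R}^n$, and its unit ball is $C=\{x:\|x\|\leq 1\}$. The two-planes considered are arbitrary affine planes, not necessarily through the origin. "Ellipse" here means the two-dimensional region bounded by a nondegenerate ellipse in the plane. $\mathcal{I}(3)$ is the group of all bijections of $V$ preserving the distance $\|x-y\|$, and $\mathcal{T}(3)$ is the group of all translations of $\mathbb{R}^3$. *)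

theory Defs
  imports "HOL-Analysis.Analysis" "HOL-Algebra.Bij"
begin

text \<open>
  Euclidean space serves only as the underlying vector space; the Minkowski norm is a separate
  function \<open>N\<close>. The library class of normed spaces is not usable for this, because the norm
  attached to the type \<open>real ^ 'n\<close> is the Euclidean one.
\<close>

definition minkowski_norm :: "(real ^ 'n \<Rightarrow> real) \<Rightarrow> bool" where
  "minkowski_norm N \<longleftrightarrow>
     (\<forall>x. 0 \<le> N x) \<and>
     (\<forall>x. N x = 0 \<longleftrightarrow> x = 0) \<and>
     (\<forall>c x. N (c *\<^sub>R x) = \<bar>c\<bar> * N x) \<and>
     (\<forall>x y. N (x + y) \<le> N x + N y)"

definition unit_ball :: "(real ^ 'n \<Rightarrow> real) \<Rightarrow> (real ^ 'n) set" where
  "unit_ball N = {x. N x \<le> 1}"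

definition two_plane :: "(real ^ 'n) set \<Rightarrow> bool" where
  "two_plane P \<longleftrightarrow> affine P \<and> aff_dim P = 2"

text \<open>
  The filled ellipse with centre \<open>c\<close> and semi-axis vectors \<open>u\<close>, \<open>v\<close>. The Euclidean structure used
  to speak of axes is immaterial, see \<open>ellipse_iff_affine_disc\<close> below.
\<close>

definition ellipse :: "(real ^ 'n) set \<Rightarrow> bool" where
  "ellipse E \<longleftrightarrow>
     (\<exists>c u v. u \<noteq> 0 \<and> v \<noteq> 0 \<and> u \<bullet> v = 0 \<and>
        E = {c + s *\<^sub>R u + t *\<^sub>R v | s t. s\<^sup>2 + t\<^sup>2 \<le> 1})"

lemma ellipse_iff_affine_disc:
  fixes E :: "(real ^ 'n) set"
  shows "ellipse E \<longleftrightarrow>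
    (\<exists>c u v. u \<noteq> v \<and> independent {u, v} \<and>
       E = {c + s *\<^sub>R u + t *\<^sub>R v | s t. s\<^sup>2 + t\<^sup>2 \<le> 1})"
proof
  assume "ellipse E"
  then obtain c u v where uv: "u \<noteq> 0" "v \<noteq> 0" "u \<bullet> v = 0"
    and E: "E = {c + s *\<^sub>R u + t *\<^sub>R v | s t. s\<^sup>2 + t\<^sup>2 \<le> 1}"
    unfolding ellipse_def by blast
  have "pairwise orthogonal {u, v}"
    using uv by (auto simp: pairwise_def orthogonal_def inner_commute)
  then have "independent {u, v}"
    using uv by (intro pairwise_orthogonal_independent) auto
  moreover have "u \<noteq> v" using uv by auto
  ultimately show "\<exists>c u v. u \<noteq> v \<and> independent {u, v} \<and>
       E = {c + s *\<^sub>R u + t *\<^sub>R v | s t. s\<^sup>2 + t\<^sup>2 \<le> 1}"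
    using E by blast
next
  assume "\<exists>c u v. u \<noteq> v \<and> independent {u, v} \<and>
       E = {c + s *\<^sub>R u + t *\<^sub>R v | s t. s\<^sup>2 + t\<^sup>2 \<le> 1}"
  then obtain c u v where uv: "u \<noteq> v" "independent {u, v}"
    and E: "E = {c + s *\<^sub>R u + t *\<^sub>R v | s t. s\<^sup>2 + t\<^sup>2 \<le> 1}"
    by blast
  have ind: "a = 0 \<and> b = 0" if "a *\<^sub>R u + b *\<^sub>R v = 0" for a b
  proof -
    have "(\<Sum>x\<in>{u, v}. (if x = u then a else b) *\<^sub>R x) = 0"
      using uv that by simp
    then have "\<forall>x\<in>{u, v}. (if x = u then a else b) = 0"
      using uv(2)[unfolded independent_explicit, THEN conjunct2,
        THEN spec[of _ "\<lambda>x. if x = u then a else b"]] by blast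
    then show ?thesis using uv(1) by auto
  qed
  define U where "U \<theta> = cos \<theta> *\<^sub>R u + sin \<theta> *\<^sub>R v" for \<theta> :: real
  define W where "W \<theta> = (- sin \<theta>) *\<^sub>R u + cos \<theta> *\<^sub>R v" for \<theta> :: real
  define f where "f \<theta> = U \<theta> \<bullet> W \<theta>" for \<theta> :: real
  have cont: "continuous_on {0..pi/2} f"
    unfolding f_def U_def W_def by (intro continuous_intros)
  have f0: "f 0 = u \<bullet> v" and f1: "f (pi/2) = - (u \<bullet> v)"
    by (simp_all add: f_def U_def W_def inner_commute)
  have "\<exists>\<theta>. f \<theta> = 0"
  proof (cases "u \<bullet> v \<le> 0")
    case True
    then show ?thesis using IVT'[of f 0 0 "pi/2"] cont f0 f1 by auto
  next
    case False
    then show ?thesis using IVT2'[of f "pi/2" 0 0] cont f0 f1 by auto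
  qed
  then obtain \<theta> where th: "U \<theta> \<bullet> W \<theta> = 0" unfolding f_def by blast
  have U0: "U \<theta> \<noteq> 0" and W0: "W \<theta> \<noteq> 0"
    using ind[of "cos \<theta>" "sin \<theta>"] ind[of "- sin \<theta>" "cos \<theta>"] sin_zero_abs_cos_one[of \<theta>]
    unfolding U_def W_def by auto
  have rot: "(cos \<theta> * s - sin \<theta> * t)\<^sup>2 + (sin \<theta> * s + cos \<theta> * t)\<^sup>2 = s\<^sup>2 + t\<^sup>2" for s t
  proof -
    have "(cos \<theta> * s - sin \<theta> * t)\<^sup>2 + (sin \<theta> * s + cos \<theta> * t)\<^sup>2
        = ((sin \<theta>)\<^sup>2 + (cos \<theta>)\<^sup>2) * (s\<^sup>2 + t\<^sup>2)"
      by (simp only: power2_eq_square) algebra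
    then show ?thesis by simp
  qed
  have rot': "(cos \<theta> * s + sin \<theta> * t)\<^sup>2 + (cos \<theta> * t - sin \<theta> * s)\<^sup>2 = s\<^sup>2 + t\<^sup>2" for s t
  proof -
    have "(cos \<theta> * s + sin \<theta> * t)\<^sup>2 + (cos \<theta> * t - sin \<theta> * s)\<^sup>2
        = ((sin \<theta>)\<^sup>2 + (cos \<theta>)\<^sup>2) * (s\<^sup>2 + t\<^sup>2)"
      by (simp only: power2_eq_square) algebra
    then show ?thesis by simp
  qed
  have eq: "c + s *\<^sub>R U \<theta> + t *\<^sub>R W \<theta>
      = c + (cos \<theta> * s - sin \<theta> * t) *\<^sub>R u + (sin \<theta> * s + cos \<theta> * t) *\<^sub>R v" for s t
    by (simp add: U_def W_def algebra_simps)
  have eq': "c + s *\<^sub>R u + t *\<^sub>R v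
      = c + (cos \<theta> * s + sin \<theta> * t) *\<^sub>R U \<theta> + (cos \<theta> * t - sin \<theta> * s) *\<^sub>R W \<theta>" for s t
  proof -
    have 1: "cos \<theta> * (cos \<theta> * s + sin \<theta> * t) - sin \<theta> * (cos \<theta> * t - sin \<theta> * s) = s"
    proof -
      have "cos \<theta> * (cos \<theta> * s + sin \<theta> * t) - sin \<theta> * (cos \<theta> * t - sin \<theta> * s)
          = ((sin \<theta>)\<^sup>2 + (cos \<theta>)\<^sup>2) * s"
        by (simp only: power2_eq_square) algebra
      then show ?thesis by simp
    qed
    have 2: "sin \<theta> * (cos \<theta> * s + sin \<theta> * t) + cos \<theta> * (cos \<theta> * t - sin \<theta> * s) = t"
    proof -
      have "sin \<theta> * (cos \<theta> * s + sin \<theta> * t) + cos \<theta> * (cos \<theta> * t - sin \<theta> * s)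
          = ((sin \<theta>)\<^sup>2 + (cos \<theta>)\<^sup>2) * t"
        by (simp only: power2_eq_square) algebra
      then show ?thesis by simp
    qed
    show ?thesis unfolding eq 1 2 ..
  qed
  have "E = {c + s *\<^sub>R U \<theta> + t *\<^sub>R W \<theta> | s t. s\<^sup>2 + t\<^sup>2 \<le> 1}" (is "_ = ?D")
  proof
    show "E \<subseteq> ?D"
    proof
      fix x assume "x \<in> E"
      then obtain s t where x: "x = c + s *\<^sub>R u + t *\<^sub>R v" and st: "s\<^sup>2 + t\<^sup>2 \<le> 1"
        unfolding E by blast
      show "x \<in> ?D" unfolding x eq' using st rot'[of s t] by force
    qed
    show "?D \<subseteq> E"
    proof
      fix x assume "x \<in> ?D"
      then obtain s t where x: "x = c + s *\<^sub>R U \<theta> + t *\<^sub>R W \<theta>" and st: "s\<^sup>2 + t\<^sup>2 \<le> 1"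
        by blast
      show "x \<in> E" unfolding x eq E using st rot[of s t] by force
    qed
  qed
  then show "ellipse E" unfolding ellipse_def using U0 W0 th by blast
qed

definition isometry_group :: "(real ^ 'n \<Rightarrow> real) \<Rightarrow> (real ^ 'n \<Rightarrow> real ^ 'n) monoid" where
  "isometry_group N =
    \<lparr>carrier = {f. bij f \<and> (\<forall>x y. N (f x - f y) = N (x - y))},
     monoid.mult = (\<circ>), one = id\<rparr>"

definition translation_group :: "(real ^ 'n \<Rightarrow> real ^ 'n) monoid" where
  "translation_group =
    \<lparr>carrier = range (\<lambda>a x. x + a), monoid.mult = (\<circ>), one = id\<rparr>"

definition unimodular_group :: "(real ^ 'n \<Rightarrow> real ^ 'n) monoid" where
  "unimodular_group =
    \<lparr>carrier = {f. linear f \<and> (det (matrix f) = 1 \<or> det (matrix f) = - 1)},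
     monoid.mult = (\<circ>), one = id\<rparr>"

definition semidirect_product ::
  "('a, 'm) monoid_scheme \<Rightarrow> ('b, 'k) monoid_scheme \<Rightarrow> ('b \<Rightarrow> 'a \<Rightarrow> 'a) \<Rightarrow> ('a \<times> 'b) monoid"
where
  "semidirect_product G H \<phi> =
    \<lparr>carrier = carrier G \<times> carrier H,
     monoid.mult = (\<lambda>(g, h) (g', h'). (g \<otimes>\<^bsub>G\<^esub> \<phi> h g', h \<otimes>\<^bsub>H\<^esub> h')),
     one = (\<one>\<^bsub>G\<^esub>, \<one>\<^bsub>H\<^esub>)\<rparr>"

text \<open>
  Linear automorphisms act on translations by conjugation, as in the affine group. The restriction
  makes the action land in the (extensional) automorphism group of the library.
\<close>

definition conj_translation ::
  "(real ^ 'n \<Rightarrow> real ^ 'n) \<Rightarrow> (real ^ 'n \<Rightarrow> real ^ 'n) \<Rightarrow> (real ^ 'n \<Rightarrow> real ^ 'n)"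
where
  "conj_translation h = (\<lambda>\<tau> \<in> carrier translation_group. h \<circ> \<tau> \<circ> inv_into UNIV h)"

lemma group_isometry_group: "group (isometry_group N)"
proof (rule groupI)
  fix f assume f: "f \<in> carrier (isometry_group N)"
  then have b: "bij f" and d: "N (f x - f y) = N (x - y)" for x y
    by (auto simp: isometry_group_def)
  have "N (inv_into UNIV f x - inv_into UNIV f y) = N (x - y)" for x y
    using d[of "inv_into UNIV f x" "inv_into UNIV f y"] b by (simp add: bij_is_surj surj_f_inv_f)
  then have "inv_into UNIV f \<in> carrier (isometry_group N)"
    using b by (simp add: isometry_group_def bij_imp_bij_inv)
  moreover have "inv_into UNIV f \<otimes>\<^bsub>isometry_group N\<^esub> f = \<one>\<^bsub>isometry_group N\<^esub>"
    using b by (simp add: isometry_group_def bij_is_inj)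
  ultimately show "\<exists>g\<in>carrier (isometry_group N).
      g \<otimes>\<^bsub>isometry_group N\<^esub> f = \<one>\<^bsub>isometry_group N\<^esub>"
    by blast
qed (auto simp: isometry_group_def bij_comp comp_assoc)

lemma group_translation_group: "group (translation_group :: (real ^ 'n \<Rightarrow> real ^ 'n) monoid)"
proof (rule groupI)
  fix f :: "real ^ 'n \<Rightarrow> real ^ 'n" assume "f \<in> carrier translation_group"
  then obtain a where f: "f = (\<lambda>x. x + a)" by (auto simp: translation_group_def)
  have "(\<lambda>x. x + (- a)) \<in> carrier translation_group"
    unfolding translation_group_def partial_object.simps
    by (rule rangeI[of "\<lambda>a x. x + a" "- a"])
  moreover have "(\<lambda>x. x + (- a)) \<otimes>\<^bsub>translation_group\<^esub> f = \<one>\<^bsub>translation_group\<^esub>"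
    by (auto simp: f translation_group_def)
  ultimately show "\<exists>g\<in>carrier translation_group.
      g \<otimes>\<^bsub>translation_group\<^esub> f = \<one>\<^bsub>translation_group\<^esub>"
    by blast
next
  have "(id :: real ^ 'n \<Rightarrow> real ^ 'n) = (\<lambda>x. x + 0)" by (simp add: id_def)
  then show "\<one>\<^bsub>translation_group\<^esub> \<in> carrier (translation_group :: (real ^ 'n \<Rightarrow> real ^ 'n) monoid)"
    unfolding translation_group_def partial_object.simps monoid.simps by (rule range_eqI)
next
  fix f g :: "real ^ 'n \<Rightarrow> real ^ 'n"
  assume "f \<in> carrier translation_group" "g \<in> carrier translation_group"
  then obtain a b where "f = (\<lambda>x. x + a)" "g = (\<lambda>x. x + b)"
    by (auto simp: translation_group_def)
  then have "f \<circ> g = (\<lambda>x. x + (b + a))" by (auto simp: add.assoc)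
  then show "f \<otimes>\<^bsub>translation_group\<^esub> g \<in> carrier translation_group"
    unfolding translation_group_def by auto
qed (auto simp: translation_group_def comp_assoc)

lemma unimodular_bij:
  assumes "h \<in> carrier (unimodular_group :: (real ^ 'n \<Rightarrow> real ^ 'n) monoid)"
  shows "linear h" "bij h" "linear (inv_into UNIV h)"
proof -
  show l: "linear h" using assms by (simp add: unimodular_group_def)
  have "invertible (matrix h)"
    using assms by (auto simp: unimodular_group_def invertible_det_nz)
  then obtain g where g: "linear g" "h \<circ> g = id" "g \<circ> h = id"
    using matrix_invertible[OF l] by blast
  then show "bij h" using o_bij by blast
  have "inv_into UNIV h = g" using g by (metis inv_unique_comp)
  then show "linear (inv_into UNIV h)" using g by simp
qed

lemma group_unimodular_group: "group (unimodular_group :: (real ^ 'n \<Rightarrow> real ^ 'n) monoid)"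
proof (rule groupI)
  fix f :: "real ^ 'n \<Rightarrow> real ^ 'n" assume f: "f \<in> carrier unimodular_group"
  note b = unimodular_bij[OF f]
  have c: "inv_into UNIV f \<circ> f = id" using b(2) by (simp add: bij_is_inj)
  have "det (matrix (inv_into UNIV f)) * det (matrix f) = 1"
    using arg_cong[OF matrix_compose[OF b(1) b(3)], of det] unfolding c
    by (simp add: det_mul matrix_id_mat_1)
  then have "det (matrix (inv_into UNIV f)) = 1 \<or> det (matrix (inv_into UNIV f)) = - 1"
    using f by (auto simp: unimodular_group_def)
  then have "inv_into UNIV f \<in> carrier unimodular_group"
    using b(3) by (simp add: unimodular_group_def)
  then show "\<exists>g\<in>carrier unimodular_group. g \<otimes>\<^bsub>unimodular_group\<^esub> f = \<one>\<^bsub>unimodular_group\<^esub>"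
    using c by (auto simp: unimodular_group_def)
qed (auto simp: unimodular_group_def comp_assoc linear_compose matrix_compose det_mul
       matrix_id_mat_1 linear_id)

lemma conj_translation_shift:
  assumes "h \<in> carrier (unimodular_group :: (real ^ 'n \<Rightarrow> real ^ 'n) monoid)"
  shows "conj_translation h (\<lambda>x. x + a) = (\<lambda>x. x + h a)"
  using unimodular_bij[OF assms]
  by (auto simp: conj_translation_def translation_group_def linear_add bij_is_surj surj_f_inv_f)

lemma conj_translation_hom:
  "conj_translation \<in> hom (unimodular_group :: (real ^ 'n \<Rightarrow> real ^ 'n) monoid)
     (AutoGroup translation_group)"
proof -
  let ?T = "translation_group :: (real ^ 'n \<Rightarrow> real ^ 'n) monoid"
  let ?L = "unimodular_group :: (real ^ 'n \<Rightarrow> real ^ 'n) monoid"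
  have T: "\<exists>a. \<tau> = (\<lambda>x. x + a)" if "\<tau> \<in> carrier ?T" for \<tau>
    using that by (auto simp: translation_group_def)
  have T': "(\<lambda>x. x + a) \<in> carrier ?T" for a by (simp add: translation_group_def)
  have comp: "(\<lambda>x. x + a) \<otimes>\<^bsub>?T\<^esub> (\<lambda>x. x + b) = (\<lambda>x. x + (b + a))" for a b
    by (auto simp: translation_group_def add.assoc)
  have au: "conj_translation h \<in> auto ?T" if h: "h \<in> carrier ?L" for h
  proof -
    note b = unimodular_bij[OF h] and s = conj_translation_shift[OF h]
    have "conj_translation h \<in> hom ?T ?T"
    proof (rule homI)
      show "conj_translation h \<tau> \<in> carrier ?T" if "\<tau> \<in> carrier ?T" for \<tau>
        using T[OF that] s T' by auto
      show "conj_translation h (\<tau> \<otimes>\<^bsub>?T\<^esub> \<sigma>) = conj_translation h \<tau> \<otimes>\<^bsub>?T\<^esub> conj_translation h \<sigma>"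
        if "\<tau> \<in> carrier ?T" "\<sigma> \<in> carrier ?T" for \<tau> \<sigma>
        using T[OF that(1)] T[OF that(2)] b(1) by (auto simp: s comp linear_add)
    qed
    moreover have "bij_betw (conj_translation h) (carrier ?T) (carrier ?T)"
    proof (rule bij_betwI')
      show "conj_translation h \<tau> \<in> carrier ?T" if "\<tau> \<in> carrier ?T" for \<tau>
        using T[OF that] s T' by auto
      show "\<exists>\<tau>\<in>carrier ?T. \<sigma> = conj_translation h \<tau>" if "\<sigma> \<in> carrier ?T" for \<sigma>
      proof -
        from T[OF that] obtain a where "\<sigma> = (\<lambda>x. x + a)" by blast
        then have "\<sigma> = conj_translation h (\<lambda>x. x + inv_into UNIV h a)"
          using b(2) by (simp add: s bij_is_surj surj_f_inv_f)
        then show ?thesis using T' by blast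
      qed
      show "conj_translation h \<tau> = conj_translation h \<sigma> \<longleftrightarrow> \<tau> = \<sigma>"
        if "\<tau> \<in> carrier ?T" "\<sigma> \<in> carrier ?T" for \<tau> \<sigma>
      proof -
        from T[OF that(1)] T[OF that(2)] obtain a c
          where "\<tau> = (\<lambda>x. x + a)" "\<sigma> = (\<lambda>x. x + c)" by blast
        then show ?thesis
          using b(2) by (simp add: s) (simp add: fun_eq_iff bij_is_inj inj_eq)
      qed
    qed
    moreover have "conj_translation h \<in> extensional (carrier ?T)"
      by (simp add: conj_translation_def)
    ultimately show ?thesis by (simp add: auto_def Bij_def)
  qed
  show ?thesis
  proof (rule homI)
    show "conj_translation h \<in> carrier (AutoGroup ?T)" if "h \<in> carrier ?L" for h
      using au[OF that] by (simp add: AutoGroup_def)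
    show "conj_translation (h \<otimes>\<^bsub>?L\<^esub> k) = conj_translation h \<otimes>\<^bsub>AutoGroup ?T\<^esub> conj_translation k"
      if hk: "h \<in> carrier ?L" "k \<in> carrier ?L" for h k
    proof -
      have hk': "h \<circ> k \<in> carrier ?L"
        using group.is_monoid[OF group_unimodular_group] hk monoid.m_closed
        by (fastforce simp: unimodular_group_def)
      have "conj_translation h \<otimes>\<^bsub>AutoGroup ?T\<^esub> conj_translation k
          = compose (carrier ?T) (conj_translation h) (conj_translation k)"
        using au hk by (simp add: AutoGroup_def BijGroup_def auto_def)
      also have "\<dots> = conj_translation (h \<circ> k)"
      proof (rule extensionalityI[of _ "carrier ?T"])
        show "compose (carrier ?T) (conj_translation h) (conj_translation k) \<tau>
            = conj_translation (h \<circ> k) \<tau>" if "\<tau> \<in> carrier ?T" for \<tau>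
          using T[OF that] T' hk hk'
          by (auto simp: compose_def conj_translation_shift)
      qed (simp_all add: conj_translation_def)
      finally show ?thesis by (simp add: unimodular_group_def)
    qed
  qed
qed

lemma group_semidirect_product:
  assumes G: "group G" and H: "group H" and \<phi>: "\<phi> \<in> hom H (AutoGroup G)"
  shows "group (semidirect_product G H \<phi>)"
proof -
  interpret G: group G by (rule G)
  interpret H: group H by (rule H)
  have au: "\<phi> h \<in> auto G" if "h \<in> carrier H" for h
    using hom_in_carrier[OF \<phi> that] by (simp add: AutoGroup_def)
  then have hm: "\<phi> h \<in> hom G G" if "h \<in> carrier H" for h
    using that by (simp add: auto_def)
  have cl: "\<phi> h g \<in> carrier G" if "h \<in> carrier H" "g \<in> carrier G" for h g
    using hom_in_carrier[OF hm] that by blast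
  have mu: "\<phi> (h \<otimes>\<^bsub>H\<^esub> k) g = \<phi> h (\<phi> k g)"
    if "h \<in> carrier H" "k \<in> carrier H" "g \<in> carrier G" for h k g
    using hom_mult[OF \<phi> that(1,2)] au that
    by (simp add: AutoGroup_def BijGroup_def auto_def compose_def)
  have one: "\<phi> \<one>\<^bsub>H\<^esub> g = g" if "g \<in> carrier G" for g
    using hom_one[OF \<phi> H G.AutoGroup] that by (simp add: AutoGroup_def BijGroup_def)
  show ?thesis
  proof (rule groupI)
    fix x assume "x \<in> carrier (semidirect_product G H \<phi>)"
    then obtain g h where x: "x = (g, h)" and gh: "g \<in> carrier G" "h \<in> carrier H"
      by (auto simp: semidirect_product_def)
    let ?k = "m_inv H h"
    have k: "?k \<in> carrier H" using gh by simp
    have "(\<phi> ?k (m_inv G g), ?k) \<in> carrier (semidirect_product G H \<phi>)"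
      using gh k cl by (simp add: semidirect_product_def)
    moreover have "\<phi> ?k (m_inv G g) \<otimes>\<^bsub>G\<^esub> \<phi> ?k g = \<one>\<^bsub>G\<^esub>"
      using hom_mult[OF hm[OF k], of "m_inv G g" g] gh hom_one[OF hm[OF k] G G] by simp
    then have "(\<phi> ?k (m_inv G g), ?k) \<otimes>\<^bsub>semidirect_product G H \<phi>\<^esub> x
        = \<one>\<^bsub>semidirect_product G H \<phi>\<^esub>"
      using gh by (simp add: x semidirect_product_def)
    ultimately show "\<exists>y\<in>carrier (semidirect_product G H \<phi>).
        y \<otimes>\<^bsub>semidirect_product G H \<phi>\<^esub> x = \<one>\<^bsub>semidirect_product G H \<phi>\<^esub>"
      by blast
  qed (auto simp: semidirect_product_def cl mu one hom_mult[OF hm] G.m_assoc H.m_assoc)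
qed

end

theory Submission
  imports Defs
begin

text \<open>
  By the Mazur-Ulam theorem an isometry of \<open>N\<close> is a translation composed with a linear map
  preserving \<open>N\<close>, so the isometry group is the semidirect product of the translations with the
  group \<open>H\<close> of linear isometries. A linear isometry maps the unit ball onto itself, hence
  preserves its volume and has determinant \<open>1\<close> or \<open>- 1\<close>. What remains is that \<open>H\<close> is finite when
  no plane section of the ball is an ellipse.

  Suppose \<open>H\<close> is infinite. Its elements form a bounded set of matrices, so some two distinct ones
  with equal determinant are arbitrarily close, and \<open>H\<close> contains elements \<open>h \<noteq> id\<close> of determinant
  \<open>1\<close> arbitrarily close to the identity. In dimension three such an \<open>h\<close> has a positive eigenvalue,
  which must be \<open>1\<close>, and then the theorem of Cayley and Hamilton reads
  \<open>(h - 1) (h\<^sup>2 - s h + 1) = 0\<close> with \<open>s = tr h - 1\<close>. On the range of \<open>h - 1\<close> the map \<open>h\<close> thus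
  satisfies \<open>h + h\<inverse> = s\<close>. Here \<open>s\<close> is close to \<open>2\<close>, and boundedness of the powers of \<open>h\<close>
  forces \<open>s < 2\<close>, so that \<open>s = 2 cos \<theta>\<close> with a small \<open>\<theta> > 0\<close>. So \<open>h\<close> acts there as a
  rotation by \<open>\<theta>\<close> along an ellipse, and an orbit consists of points of that ellipse spaced by
  \<open>\<theta>\<close>, all of the same norm. As \<open>h\<close> tends to the identity, \<open>\<theta>\<close> tends to \<open>0\<close>, and by
  compactness these ellipses accumulate at one that lies entirely on the unit sphere of \<open>N\<close>. Its
  plane cuts the unit ball in an ellipse.
\<close>

section \<open>Minkowski norms\<close>

locale minkowski_space =
  fixes N :: "real ^ 'n \<Rightarrow> real"
  assumes minkowski: "minkowski_norm N"
begin

lemma nonneg: "0 \<le> N x"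
  and eq_0_iff: "N x = 0 \<longleftrightarrow> x = 0"
  and scale: "N (c *\<^sub>R x) = \<bar>c\<bar> * N x"
  and triangle: "N (x + y) \<le> N x + N y"
  using minkowski by (auto simp: minkowski_norm_def)

lemma zero [simp]: "N 0 = 0"
  by (simp add: eq_0_iff)

lemma minus: "N (- x) = N x"
  using scale[of "-1" x] by simp

lemma minus_commute: "N (x - y) = N (y - x)"
  using minus[of "x - y"] by simp

lemma triangle_diff: "N (x - y) \<le> N x + N y"
  using triangle[of x "- y"] by (simp add: minus)

lemma pos: "x \<noteq> 0 \<Longrightarrow> 0 < N x"
  using nonneg[of x] eq_0_iff[of x] by linarith

lemma continuous: "continuous_on S N"
proof -
  have "convex_on UNIV N"
  proof (rule convex_onI)
    fix t :: real and x y assume "0 < t" "t < 1"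
    then show "N ((1 - t) *\<^sub>R x + t *\<^sub>R y) \<le> (1 - t) * N x + t * N y"
      using triangle[of "(1 - t) *\<^sub>R x" "t *\<^sub>R y"] by (simp add: scale)
  qed simp
  then show ?thesis
    using convex_on_continuous[OF open_UNIV] continuous_on_subset by blast
qed

lemma equivalent_to_norm:
  obtains m K where "0 < m" "0 < K" "\<And>x. m * norm x \<le> N x" "\<And>x. N x \<le> K * norm x"
proof -
  have S: "compact (sphere (0 :: real ^ 'n) 1)" "sphere (0 :: real ^ 'n) 1 \<noteq> {}"
    by auto
  obtain a where a: "a \<in> sphere 0 1" "\<And>x. x \<in> sphere 0 1 \<Longrightarrow> N a \<le> N x"
    using continuous_attains_inf[OF S continuous] by blast
  obtain b where b: "b \<in> sphere 0 1" "\<And>x. x \<in> sphere 0 1 \<Longrightarrow> N x \<le> N b"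
    using continuous_attains_sup[OF S continuous] by blast
  have eq: "N x = norm x * N (x /\<^sub>R norm x)" and S': "x /\<^sub>R norm x \<in> sphere 0 1"
    if "x \<noteq> 0" for x :: "real ^ 'n"
    using that by (auto simp: scale)
  have "N a * norm x \<le> N x" "N x \<le> N b * norm x" for x
  proof -
    show "N a * norm x \<le> N x"
      using eq[of x] a(2)[OF S', of x] mult_left_mono[of "N a" "N (x /\<^sub>R norm x)" "norm x"]
      by (cases "x = 0") (auto simp: mult.commute)
    show "N x \<le> N b * norm x"
      using eq[of x] b(2)[OF S', of x] mult_left_mono[of "N (x /\<^sub>R norm x)" "N b" "norm x"]
      by (cases "x = 0") (auto simp: mult.commute)
  qed
  moreover have "0 < N a" "0 < N b"
    using a(1) b(1) by (auto intro!: pos)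
  ultimately show ?thesis
    using that by blast
qed

end


section \<open>The Mazur-Ulam theorem\<close>

definition norm_isometries :: "(real ^ 'n \<Rightarrow> real) \<Rightarrow> (real ^ 'n \<Rightarrow> real ^ 'n) set" where
  "norm_isometries N = {f. bij f \<and> (\<forall>x y. N (f x - f y) = N (x - y))}"

definition linear_isometries :: "(real ^ 'n \<Rightarrow> real) \<Rightarrow> (real ^ 'n \<Rightarrow> real ^ 'n) set" where
  "linear_isometries N = {f. linear f \<and> (\<forall>x. N (f x) = N x)}"

lemma carrier_isometry_group: "carrier (isometry_group N) = norm_isometries N"
  by (simp add: isometry_group_def norm_isometries_def)

lemma norm_isometries_comp:
  "f \<in> norm_isometries N \<Longrightarrow> g \<in> norm_isometries N \<Longrightarrow> f \<circ> g \<in> norm_isometries N"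
  by (auto simp: norm_isometries_def intro: bij_comp)

lemma norm_isometries_inv:
  assumes "f \<in> norm_isometries N"
  shows "inv_into UNIV f \<in> norm_isometries N"
proof -
  have b: "bij f" and d: "\<And>x y. N (f x - f y) = N (x - y)"
    using assms by (auto simp: norm_isometries_def)
  have "N (inv_into UNIV f x - inv_into UNIV f y) = N (x - y)" for x y
    using d[of "inv_into UNIV f x" "inv_into UNIV f y"] b by (simp add: bij_is_surj surj_f_inv_f)
  then show ?thesis
    using b by (simp add: norm_isometries_def bij_imp_bij_inv)
qed

context minkowski_space
begin

lemma point_reflection_isometry: "(\<lambda>x. p - x) \<in> norm_isometries N"
proof -
  have "bij (\<lambda>x. p - x)"
    by (rule o_bij[of "\<lambda>x. p - x"]) (auto simp: fun_eq_iff)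
  moreover have "N ((p - x) - (p - y)) = N (x - y)" for x y
    by (simp add: minus_commute)
  ultimately show ?thesis
    by (simp add: norm_isometries_def)
qed

text \<open>
  This is the key step of Vaisala's proof of the Mazur-Ulam theorem. If \<open>g\<close> fixes \<open>a\<close> and \<open>b\<close> and
  \<open>\<psi>\<close> is the reflection in their midpoint \<open>z\<close>, then \<open>\<psi> g\<inverse> \<psi> g\<close> fixes \<open>a\<close> and \<open>b\<close> as well and moves
  \<open>z\<close> twice as far as \<open>g\<close> does. All these displacements are bounded by twice the distance of \<open>z\<close>
  from \<open>a\<close>, so repeated doubling shows that they vanish.
\<close>

lemma isometry_fixes_midpoint:
  assumes "g \<in> norm_isometries N" "g a = a" "g b = b"
  shows "g ((1/2) *\<^sub>R (a + b)) = (1/2) *\<^sub>R (a + b)"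
proof -
  define z where "z = (1/2) *\<^sub>R (a + b)"
  define \<psi> where "\<psi> x = (a + b) - x" for x
  have \<psi>: "\<psi> \<in> norm_isometries N"
    unfolding \<psi>_def by (rule point_reflection_isometry)
  have zz: "z + z = a + b"
    by (simp add: z_def scaleR_left_distrib[symmetric])
  have bound: "2 ^ k * N (g z - z) \<le> 2 * N (z - a)"
    if "g \<in> norm_isometries N" "g a = a" "g b = b" for k g
    using that
  proof (induction k arbitrary: g)
    case 0
    have "N (g z - g a) = N (z - a)"
      using 0(1) by (auto simp: norm_isometries_def)
    then show ?case
      using triangle[of "g z - a" "a - z"] 0 minus_commute[of a z] by simp
  next
    case (Suc k)
    define g' where "g' = \<psi> \<circ> inv_into UNIV g \<circ> \<psi> \<circ> g"
    have bg: "bij g"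
      using Suc.prems by (auto simp: norm_isometries_def)
    have fix_inv: "inv_into UNIV g a = a" "inv_into UNIV g b = b"
      using bg Suc.prems by (metis bij_inv_eq_iff)+
    have g': "g' \<in> norm_isometries N"
      unfolding g'_def
      by (intro norm_isometries_comp norm_isometries_inv \<psi> Suc.prems)
    have "g' a = a" "g' b = b"
      using Suc.prems fix_inv by (simp_all add: g'_def \<psi>_def)
    from Suc.IH[OF g' this] have IH: "2 ^ k * N (g' z - z) \<le> 2 * N (z - a)" .
    have "g' z - z = z - inv_into UNIV g (\<psi> (g z))"
      using zz by (simp add: g'_def \<psi>_def algebra_simps)
    also have "N \<dots> = N (inv_into UNIV g (g z) - inv_into UNIV g (\<psi> (g z)))"
      using bg by (simp add: bij_is_inj)
    also have "\<dots> = N (g z - \<psi> (g z))"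
      using norm_isometries_inv[OF Suc.prems(1)] by (simp add: norm_isometries_def)
    also have "g z - \<psi> (g z) = 2 *\<^sub>R (g z - z)"
      using zz by (simp add: \<psi>_def scaleR_2 algebra_simps)
    finally show ?case
      using IH by (simp add: scale)
  qed
  have "N (g z - z) = 0"
  proof (rule ccontr)
    assume "N (g z - z) \<noteq> 0"
    then have p: "0 < N (g z - z)"
      using nonneg[of "g z - z"] by linarith
    obtain k where "2 * N (z - a) / N (g z - z) < 2 ^ k"
      using real_arch_pow[of 2] by force
    then show False
      using bound[OF assms, of k] p by (simp add: field_simps)
  qed
  then show ?thesis
    by (simp add: eq_0_iff z_def)
qed

lemma isometry_midpoint:
  assumes f: "f \<in> norm_isometries N"
  shows "f ((1/2) *\<^sub>R (a + b)) = (1/2) *\<^sub>R (f a + f b)"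
proof -
  (* carrying the midpoint reflection of the images back through f gives an isometry that
     exchanges a and b; composed with the midpoint reflection of a and b it fixes both *)
  define h where "h = (\<lambda>x. (a + b) - x) \<circ> inv_into UNIV f \<circ> (\<lambda>x. (f a + f b) - x) \<circ> f"
  define z where "z = (1/2) *\<^sub>R (a + b)"
  have bf: "bij f"
    using f by (simp add: norm_isometries_def)
  have zz: "(a + b) - z = z"
    by (simp add: z_def algebra_simps flip: scaleR_left_distrib)
  have "h \<in> norm_isometries N"
    unfolding h_def
    by (intro norm_isometries_comp norm_isometries_inv point_reflection_isometry f)
  moreover have "h a = a" "h b = b"
    using bf by (simp_all add: h_def bij_is_inj)
  ultimately have "h z = z"
    unfolding z_def by (rule isometry_fixes_midpoint)
  then have "(a + b) - inv_into UNIV f ((f a + f b) - f z) = (a + b) - z"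
    unfolding zz by (simp only: h_def comp_apply)
  then have "inv_into UNIV f ((f a + f b) - f z) = z"
    by simp
  then have "(f a + f b) - f z = f z"
    using bf by (metis bij_inv_eq_iff)
  then have "f a + f b = 2 *\<^sub>R f z"
    by (simp add: scaleR_2 diff_eq_eq)
  then show ?thesis
    by (simp add: z_def)
qed

text \<open>
  For a norm preserving additive map, \<open>n (g (c x) - c g x) = g (\<delta> x) - \<delta> g x\<close> where \<open>\<delta>\<close> is the
  fractional part of \<open>n c\<close>. The right-hand side is bounded independently of \<open>n\<close>.
\<close>

lemma additive_isometry_linear:
  assumes add: "\<And>x y. g (x + y) = g x + g y" and N: "\<And>x. N (g x) = N x"
  shows "linear g"
proof (rule linearI)
  have g0: "g 0 = 0"
    using add[of 0 0] by simp
  have gm: "g (- x) = - g x" for x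
    using add[of x "- x"] g0 by (simp add: eq_neg_iff_add_eq_0 add.commute)
  have gn: "g (real n *\<^sub>R x) = real n *\<^sub>R g x" for n x
    by (induction n) (simp_all add: g0 add scaleR_left_distrib)
  have gi: "g (real_of_int i *\<^sub>R x) = real_of_int i *\<^sub>R g x" for i x
    by (cases i) (simp_all add: gn gm del: of_nat_Suc)
  fix c :: real and x
  have b: "real n * N (g (c *\<^sub>R x) - c *\<^sub>R g x) \<le> 2 * N x" for n
  proof -
    define \<delta> where "\<delta> = frac (real n * c)"
    have \<delta>: "0 \<le> \<delta>" "\<delta> \<le> 1"
      using frac_lt_1[of "real n * c"] by (simp_all add: \<delta>_def)
    have nc: "real n * c = real_of_int \<lfloor>real n * c\<rfloor> + \<delta>"
      by (simp add: \<delta>_def frac_def)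
    have "real n *\<^sub>R g (c *\<^sub>R x) = g ((real n * c) *\<^sub>R x)"
      by (simp flip: gn)
    also have "\<dots> = real_of_int \<lfloor>real n * c\<rfloor> *\<^sub>R g x + g (\<delta> *\<^sub>R x)"
      by (subst nc) (simp only: scaleR_left_distrib add gi)
    finally have "real n *\<^sub>R (g (c *\<^sub>R x) - c *\<^sub>R g x) = g (\<delta> *\<^sub>R x) - \<delta> *\<^sub>R g x"
      using arg_cong[OF nc, of "\<lambda>r. r *\<^sub>R g x"] by (simp add: algebra_simps)
    from arg_cong[OF this, of N]
    have "real n * N (g (c *\<^sub>R x) - c *\<^sub>R g x) = N (g (\<delta> *\<^sub>R x) - \<delta> *\<^sub>R g x)"
      by (simp add: scale)
    also have "\<dots> \<le> \<delta> * N x + \<delta> * N x"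
      using triangle_diff[of "g (\<delta> *\<^sub>R x)" "\<delta> *\<^sub>R g x"] \<delta> by (simp add: N scale)
    also have "\<dots> \<le> 2 * N x"
      using mult_right_mono[OF \<delta>(2) nonneg[of x]] by simp
    finally show ?thesis .
  qed
  have "N (g (c *\<^sub>R x) - c *\<^sub>R g x) = 0"
  proof (rule ccontr)
    assume "N (g (c *\<^sub>R x) - c *\<^sub>R g x) \<noteq> 0"
    then have p: "0 < N (g (c *\<^sub>R x) - c *\<^sub>R g x)"
      using nonneg[of "g (c *\<^sub>R x) - c *\<^sub>R g x"] by linarith
    obtain n where "2 * N x < real n * N (g (c *\<^sub>R x) - c *\<^sub>R g x)"
      using reals_Archimedean3[OF p] by blast
    then show False
      using b[of n] by simp
  qed
  then show "g (c *\<^sub>R x) = c *\<^sub>R g x"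
    by (simp add: eq_0_iff)
qed (rule add)

theorem mazur_ulam:
  assumes f: "f \<in> norm_isometries N"
  shows "(\<lambda>x. f x - f 0) \<in> linear_isometries N"
proof -
  define g where "g x = f x - f 0" for x
  have N: "N (g x) = N x" for x
    using f by (auto simp: norm_isometries_def g_def)
  have g0: "g 0 = 0"
    by (simp add: g_def)
  have mid: "g ((1/2) *\<^sub>R (a + b)) = (1/2) *\<^sub>R (g a + g b)" for a b
    unfolding g_def isometry_midpoint[OF f] by (simp add: vec_eq_iff field_simps)
  have "g (a + b) = g a + g b" for a b
  proof -
    from mid[of "a + b" 0] mid[of a b] have "(1/2) *\<^sub>R g (a + b) = (1/2) *\<^sub>R (g a + g b)"
      by (simp only: g0 add_0_right)
    then show ?thesis
      by simp
  qed
  then have "linear g"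
    using N by (rule additive_isometry_linear)
  then show ?thesis
    using N by (simp add: linear_isometries_def g_def[abs_def])
qed

end


section \<open>The group of linear isometries\<close>

context minkowski_space
begin

lemma linear_isometry_bij:
  assumes "f \<in> linear_isometries N"
  shows "bij f"
proof -
  have l: "linear f" and N: "\<And>x. N (f x) = N x"
    using assms by (auto simp: linear_isometries_def)
  have "inj f"
    unfolding linear_injective_0[OF l] using N by (metis eq_0_iff)
  then show ?thesis
    using l linear_injective_imp_surjective by (auto simp: bij_def)
qed

lemma linear_isometry_inv:
  assumes f: "f \<in> linear_isometries N"
  shows "inv_into UNIV f \<in> linear_isometries N"
proof -
  have "linear (inv_into UNIV f)"
    using f linear_isometry_bij[OF f] inj_linear_imp_inv_linear
    by (auto simp: linear_isometries_def bij_def)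
  moreover have "N (inv_into UNIV f x) = N x" for x
  proof -
    have "N (f (inv_into UNIV f x)) = N (inv_into UNIV f x)"
      using f by (simp add: linear_isometries_def)
    then show ?thesis
      using linear_isometry_bij[OF f] by (simp add: bij_is_surj surj_f_inv_f)
  qed
  ultimately show ?thesis
    by (simp add: linear_isometries_def)
qed

lemma linear_isometry_comp:
  "f \<in> linear_isometries N \<Longrightarrow> g \<in> linear_isometries N \<Longrightarrow> f \<circ> g \<in> linear_isometries N"
  by (auto simp: linear_isometries_def linear_compose)

lemma linear_isometry_funpow:
  "f \<in> linear_isometries N \<Longrightarrow> N ((f ^^ k) x) = N x"
  by (induction k) (auto simp: linear_isometries_def)

lemma compact_unit_ball: "compact (unit_ball N)"
proof -
  obtain m where "0 < m" "\<And>x. m * norm x \<le> N x"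
    using equivalent_to_norm by metis
  then have "norm x \<le> 1 / m" if "N x \<le> 1" for x
    using that order_trans by (fastforce simp: field_simps)
  then have "bounded (unit_ball N)"
    unfolding bounded_iff unit_ball_def by auto
  moreover have "closed (unit_ball N)"
    unfolding unit_ball_def by (intro closed_Collect_le continuous continuous_on_const)
  ultimately show ?thesis
    by (simp add: compact_eq_bounded_closed)
qed

lemma unit_ball_not_negligible: "\<not> negligible (unit_ball N)"
proof -
  have "open {x. N x < 1}"
    by (intro open_Collect_less continuous continuous_on_const)
  moreover have "0 \<in> {x. N x < 1}" by simp
  ultimately have "\<not> negligible {x. N x < 1}"
    using open_not_negligible by blast
  moreover have "{x. N x < 1} \<subseteq> unit_ball N"
    by (auto simp: unit_ball_def)
  ultimately show ?thesis
    using negligible_subset by blast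
qed

lemma image_unit_ball:
  assumes f: "f \<in> linear_isometries N"
  shows "f ` unit_ball N = unit_ball N"
proof -
  have N: "\<And>x. N (f x) = N x" and b: "bij f"
    using f linear_isometry_bij by (auto simp: linear_isometries_def)
  have "x \<in> f ` unit_ball N" if "x \<in> unit_ball N" for x
    using that N[of "inv_into UNIV f x"] b
    by (intro image_eqI[of _ _ "inv_into UNIV f x"]) (auto simp: unit_ball_def bij_is_surj surj_f_inv_f)
  then show ?thesis
    using N by (auto simp: unit_ball_def)
qed

end

text \<open>The unit ball has finite positive volume and is its own image.\<close>

lemma det_linear_isometry:
  fixes N :: "real ^ 'n :: {finite, wellorder} \<Rightarrow> real"
  assumes "minkowski_norm N" and f: "f \<in> linear_isometries N"
  shows "det (matrix f) = 1 \<or> det (matrix f) = - 1"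
proof -
  interpret minkowski_space N
    using assms by unfold_locales
  have C: "unit_ball N \<in> lmeasurable"
    by (rule lmeasurable_compact[OF compact_unit_ball])
  have "linear f"
    using f by (simp add: linear_isometries_def)
  from measure_linear_image[OF this C]
  have "measure lebesgue (unit_ball N) = \<bar>det (matrix f)\<bar> * measure lebesgue (unit_ball N)"
    by (simp add: image_unit_ball[OF f])
  moreover have "measure lebesgue (unit_ball N) \<noteq> 0"
    using unit_ball_not_negligible C negligible_iff_measure0 by blast
  ultimately have "\<bar>det (matrix f)\<bar> = 1"
    by simp
  then show ?thesis
    by linarith
qed

lemma subgroup_linear_isometries:
  fixes N :: "real ^ 'n :: {finite, wellorder} \<Rightarrow> real"
  assumes N: "minkowski_norm N"
  shows "subgroup (linear_isometries N) unimodular_group"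
proof -
  interpret minkowski_space N
    using N by unfold_locales
  interpret U: group "unimodular_group :: (real ^ 'n :: _ \<Rightarrow> real ^ 'n :: _) monoid"
    by (rule group_unimodular_group)
  have sub: "linear_isometries N \<subseteq> carrier unimodular_group"
    using det_linear_isometry[OF N] by (auto simp: unimodular_group_def linear_isometries_def)
  show ?thesis
  proof (rule U.subgroupI)
    have "id \<in> linear_isometries N"
      by (simp add: linear_isometries_def linear_id)
    then show "linear_isometries N \<noteq> {}"
      by blast
  next
    fix f assume f: "f \<in> linear_isometries N"
    have "inv_into UNIV f \<in> carrier unimodular_group" "f \<in> carrier unimodular_group"
      using sub f linear_isometry_inv by auto
    moreover have "inv_into UNIV f \<circ> f = id"
      using linear_isometry_bij[OF f] by (simp add: bij_is_inj)
    ultimately have "inv\<^bsub>unimodular_group\<^esub> f = inv_into UNIV f"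
      by (intro U.inv_equality) (auto simp: unimodular_group_def)
    then show "inv\<^bsub>unimodular_group\<^esub> f \<in> linear_isometries N"
      using linear_isometry_inv[OF f] by simp
  next
    fix f g assume "f \<in> linear_isometries N" "g \<in> linear_isometries N"
    then show "f \<otimes>\<^bsub>unimodular_group\<^esub> g \<in> linear_isometries N"
      by (simp add: unimodular_group_def linear_isometry_comp)
  qed (rule sub)
qed

text \<open>
  An isometry \<open>f\<close> corresponds to the translation by \<open>f 0\<close> together with its linear part.
\<close>

theorem isometry_group_iso_semidirect:
  fixes N :: "real ^ 'n :: {finite, wellorder} \<Rightarrow> real"
  assumes N: "minkowski_norm N"
  shows "isometry_group N \<cong> semidirect_product translation_group
    (unimodular_group\<lparr>carrier := linear_isometries N\<rparr>) conj_translation"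
proof -
  interpret minkowski_space N
    using N by unfold_locales
  let ?L = "unimodular_group\<lparr>carrier := linear_isometries N\<rparr> :: (real ^ 'n :: _ \<Rightarrow> real ^ 'n :: _) monoid"
  let ?S = "semidirect_product translation_group ?L conj_translation"
  define \<Phi> where "\<Phi> f = ((\<lambda>x. x + f 0), (\<lambda>x. f x - f 0))" for f :: "real ^ 'n :: _ \<Rightarrow> real ^ 'n :: _"
  have carrier: "carrier ?S = range (\<lambda>a x. x + a) \<times> linear_isometries N"
    by (simp add: semidirect_product_def translation_group_def)
  have "\<Phi> \<in> hom (isometry_group N) ?S"
  proof (rule homI)
    fix f assume "f \<in> carrier (isometry_group N)"
    then show "\<Phi> f \<in> carrier ?S"
      unfolding carrier \<Phi>_def using mazur_ulam by (auto simp: carrier_isometry_group)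
  next
    fix f g assume fg: "f \<in> carrier (isometry_group N)" "g \<in> carrier (isometry_group N)"
    define a f' where "a = f 0" and "f' x = f x - f 0" for x
    have f': "f' \<in> linear_isometries N"
      unfolding f'_def[abs_def] using mazur_ulam fg by (simp add: carrier_isometry_group)
    then have U: "f' \<in> carrier unimodular_group" and l: "linear f'"
      using subgroup.subset[OF subgroup_linear_isometries[OF N]]
      by (auto simp: linear_isometries_def)
    have ff: "f x = f' x + a" for x
      by (simp add: f'_def a_def)
    have "\<Phi> f \<otimes>\<^bsub>?S\<^esub> \<Phi> g =
        ((\<lambda>x. x + a) \<circ> conj_translation f' (\<lambda>x. x + g 0), f' \<circ> (\<lambda>x. g x - g 0))"
      by (simp add: \<Phi>_def semidirect_product_def translation_group_def unimodular_group_def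
          f'_def[abs_def] a_def)
    also have "\<dots> = \<Phi> (f \<circ> g)"
      unfolding conj_translation_shift[OF U] \<Phi>_def
      by (auto simp: fun_eq_iff ff linear_diff[OF l] linear_0[OF l] algebra_simps)
    finally show "\<Phi> (f \<otimes>\<^bsub>isometry_group N\<^esub> g) = \<Phi> f \<otimes>\<^bsub>?S\<^esub> \<Phi> g"
      by (simp add: isometry_group_def)
  qed
  moreover have "bij_betw \<Phi> (carrier (isometry_group N)) (carrier ?S)"
  proof (rule bij_betwI')
    fix f g
    show "\<Phi> f = \<Phi> g \<longleftrightarrow> f = g"
    proof
      assume "\<Phi> f = \<Phi> g"
      then have "x + f 0 = x + g 0" "f x - f 0 = g x - g 0" for x
        by (auto simp: \<Phi>_def fun_eq_iff)
      then show "f = g"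
        by (metis add_left_cancel diff_add_cancel ext)
    qed simp
  next
    fix f assume "f \<in> carrier (isometry_group N)"
    then show "\<Phi> f \<in> carrier ?S"
      unfolding carrier \<Phi>_def using mazur_ulam by (auto simp: carrier_isometry_group)
  next
    fix y assume "y \<in> carrier ?S"
    then obtain a h where y: "y = ((\<lambda>x. x + a), h)" and h: "h \<in> linear_isometries N"
      unfolding carrier by auto
    have l: "linear h" and Nh: "\<And>x. N (h x) = N x"
      using h by (auto simp: linear_isometries_def)
    have "bij ((+) a \<circ> h)"
      by (rule bij_comp[OF linear_isometry_bij[OF h]]) simp
    then have "(\<lambda>x. h x + a) \<in> carrier (isometry_group N)"
      using Nh by (simp add: isometry_group_def comp_def add.commute flip: linear_diff[OF l])
    moreover have "y = \<Phi> (\<lambda>x. h x + a)"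
      by (simp add: y \<Phi>_def linear_0[OF l])
    ultimately show "\<exists>f\<in>carrier (isometry_group N). y = \<Phi> f"
      by blast
  qed
  ultimately have "\<Phi> \<in> iso (isometry_group N) ?S"
    by (simp add: iso_def)
  then show ?thesis
    by (auto simp: is_iso_def)
qed


section \<open>Linear isometries close to the identity\<close>

context minkowski_space
begin

text \<open>
  The images of the standard basis determine a linear isometry and are bounded, so an infinite
  set of linear isometries cannot be uniformly discrete.
\<close>

lemma close_linear_isometries:
  assumes "infinite G" "G \<subseteq> linear_isometries N" "0 < \<epsilon>"
  obtains f g where "f \<in> G" "g \<in> G" "f \<noteq> g" "\<And>i. norm (f (axis i 1) - g (axis i 1)) < \<epsilon>"
proof -
  define F :: "(real ^ 'n \<Rightarrow> real ^ 'n) \<Rightarrow> real ^ 'n ^ 'n"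
    where "F f = (\<chi> i. f (axis i 1))" for f
  have inj: "inj_on F G"
  proof (rule inj_onI)
    fix f g assume fg: "f \<in> G" "g \<in> G" "F f = F g"
    have "linear f" "linear g"
      using fg assms by (auto simp: linear_isometries_def)
    moreover have "f (axis i 1) = g (axis i 1)" for i
      using arg_cong[OF fg(3), of "\<lambda>A. A $ i"] by (simp add: F_def)
    ultimately show "f = g"
      by (intro linear_eq_stdbasis) (auto simp: Basis_vec_def)
  qed
  obtain m K where m: "0 < m" "\<And>x. m * norm x \<le> N x" and K: "\<And>x. N x \<le> K * norm x"
    using equivalent_to_norm by metis
  have "norm (F f) \<le> (\<Sum>i\<in>(UNIV :: 'n set). K / m)" if f: "f \<in> G" for f
  proof -
    have "norm (f (axis i 1)) \<le> K / m" for i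
    proof -
      have "m * norm (f (axis i 1)) \<le> N (axis i 1)"
        using m(2)[of "f (axis i 1)"] f assms by (auto simp: linear_isometries_def)
      also have "\<dots> \<le> K"
        using K[of "axis i 1"] by simp
      finally show ?thesis
        using m(1) by (simp add: field_simps)
    qed
    then have "(\<Sum>i\<in>UNIV. norm (F f $ i)) \<le> (\<Sum>i\<in>(UNIV :: 'n set). K / m)"
      by (intro sum_mono) (simp add: F_def)
    moreover have "norm (F f) \<le> (\<Sum>i\<in>UNIV. norm (F f $ i))"
      unfolding norm_vec_def by (rule L2_set_le_sum) simp
    ultimately show ?thesis
      by linarith
  qed
  then have "bounded (F ` G)"
    unfolding bounded_iff by blast
  moreover have "infinite (F ` G)"
    using inj assms(1) finite_imageD by blast
  ultimately have "\<not> uniform_discrete (F ` G)"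
    using uniform_discrete_finite_iff by blast
  then obtain f g where fg: "f \<in> G" "g \<in> G" "F f \<noteq> F g" "dist (F f) (F g) < \<epsilon>"
    using \<open>0 < \<epsilon>\<close> unfolding uniform_discrete_def by blast
  have "norm (f (axis i 1) - g (axis i 1)) < \<epsilon>" for i
    using Finite_Cartesian_Product.norm_nth_le[of "F f - F g" i] fg(4) by (simp add: F_def dist_norm)
  then show ?thesis
    using that fg by blast
qed

end

text \<open>
  If \<open>f\<close> and \<open>g\<close> are close and have the same determinant, then \<open>f\<inverse> g\<close> has determinant \<open>1\<close>. It is
  close to the identity because \<open>f\<close> preserves \<open>N\<close>, and \<open>N\<close> is equivalent to the Euclidean norm.
\<close>

lemma linear_isometry_near_identity:
  fixes N :: "real ^ 'n :: {finite, wellorder} \<Rightarrow> real"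
  assumes N: "minkowski_norm N" and inf: "infinite (linear_isometries N)" and \<epsilon>: "0 < \<epsilon>"
  obtains h where "h \<in> linear_isometries N" "h \<noteq> id" "det (matrix h) = 1"
    "\<And>i. norm (h (axis i 1) - axis i 1) < \<epsilon>"
proof -
  interpret minkowski_space N
    using N by unfold_locales
  obtain m K where m: "0 < m" "\<And>x. m * norm x \<le> N x" and K: "0 < K" "\<And>x. N x \<le> K * norm x"
    using equivalent_to_norm by metis
  have "linear_isometries N = (\<Union>d\<in>{1, - 1}. {f \<in> linear_isometries N. det (matrix f) = d})"
    using det_linear_isometry[OF N] by auto
  then obtain d where d: "d \<in> {1, - 1}"
      "infinite {f \<in> linear_isometries N. det (matrix f) = d}"
    using inf by (metis (no_types, lifting) finite.intros finite_UN_I)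
  have "0 < \<epsilon> * m / K"
    using \<epsilon> m(1) K(1) by simp
  from close_linear_isometries[OF d(2) _ this]
  obtain f g where "f \<in> {f \<in> linear_isometries N. det (matrix f) = d}"
      "g \<in> {f \<in> linear_isometries N. det (matrix f) = d}" and "f \<noteq> g"
    and close: "\<And>i. norm (f (axis i 1) - g (axis i 1)) < \<epsilon> * m / K"
    by (metis (no_types, lifting) mem_Collect_eq subsetI)
  then have f: "f \<in> linear_isometries N" "det (matrix f) = d"
    and g: "g \<in> linear_isometries N" "det (matrix g) = d"
    by auto
  note f' = linear_isometry_inv[OF f(1)] and bf = linear_isometry_bij[OF f(1)]
  have lin: "linear f" "linear g" "linear (inv_into UNIV f)"
    using f g f' by (auto simp: linear_isometries_def)
  let ?h = "inv_into UNIV f \<circ> g"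
  have fh: "f (?h x) = g x" for x
    using bf by (simp add: bij_is_surj surj_f_inv_f)
  have 1: "?h \<in> linear_isometries N"
    by (intro linear_isometry_comp f' g)
  have 2: "?h \<noteq> id"
    using fh \<open>f \<noteq> g\<close> by (metis eq_id_iff ext)
  have "f \<circ> ?h = g"
    using fh by (auto simp: fun_eq_iff)
  then have "det (matrix f) * det (matrix ?h) = det (matrix g)"
    using matrix_compose[of ?h f] lin by (metis det_mul linear_compose)
  then have 3: "det (matrix ?h) = 1"
    using f(2) g(2) d(1) by auto
  have "norm (?h (axis i 1) - axis i 1) < \<epsilon>" for i
  proof -
    have "m * norm (?h (axis i 1) - axis i 1) \<le> N (?h (axis i 1) - axis i 1)"
      by (rule m)
    also have "\<dots> = N (f (axis i 1) - f (?h (axis i 1)))"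
      using f(1) lin(1) by (simp add: linear_isometries_def minus_commute flip: linear_diff)
    also have "\<dots> \<le> K * norm (f (axis i 1) - g (axis i 1))"
      unfolding fh by (rule K)
    also have "\<dots> < K * (\<epsilon> * m / K)"
      by (rule mult_strict_left_mono[OF close K(1)])
    also have "\<dots> = m * \<epsilon>"
      using K(1) by simp
    finally show ?thesis
      using m(1) by simp
  qed
  with 1 2 3 show ?thesis
    by (rule that)
qed


section \<open>The characteristic polynomial in dimension three\<close>

definition principal_minors_sum :: "real ^ 3 ^ 3 \<Rightarrow> real" where
  "principal_minors_sum A =
     (A $ 1 $ 1 * A $ 2 $ 2 - A $ 1 $ 2 * A $ 2 $ 1) +
     (A $ 1 $ 1 * A $ 3 $ 3 - A $ 1 $ 3 * A $ 3 $ 1) +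
     (A $ 2 $ 2 * A $ 3 $ 3 - A $ 2 $ 3 * A $ 3 $ 2)"

lemma char_poly_3:
  fixes A :: "real ^ 3 ^ 3"
  shows "det (x *\<^sub>R mat 1 - A) = x ^ 3 - trace A * x\<^sup>2 + principal_minors_sum A * x - det A"
  by (simp add: det_3 trace_def sum_3 principal_minors_sum_def mat_def power2_eq_square
      power3_eq_cube algebra_simps)

lemma cayley_hamilton_3:
  fixes A :: "real ^ 3 ^ 3"
  shows "A *v (A *v (A *v x)) =
    trace A *\<^sub>R (A *v (A *v x)) - principal_minors_sum A *\<^sub>R (A *v x) + det A *\<^sub>R x"
  by (simp add: vec_eq_iff forall_3 matrix_vector_mult_def sum_3 det_3 trace_def
      principal_minors_sum_def algebra_simps)

text \<open>
  The determinant of \<open>x - h\<close> is \<open>- 1\<close> at \<open>x = 0\<close> and positive for large \<open>x\<close>, so \<open>h\<close> has a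
  positive eigenvalue. This eigenvalue is \<open>1\<close> because \<open>h\<close> preserves \<open>N\<close>.
\<close>

lemma principal_minors_sum_eq_trace:
  fixes N :: "real ^ 3 \<Rightarrow> real"
  assumes N: "minkowski_norm N" and h: "h \<in> linear_isometries N" and det: "det (matrix h) = 1"
  shows "principal_minors_sum (matrix h) = trace (matrix h)"
proof -
  interpret minkowski_space N
    using N by unfold_locales
  have l: "linear h" and Nh: "\<And>x. N (h x) = N x"
    using h by (auto simp: linear_isometries_def)
  let ?t = "trace (matrix h)" and ?c = "principal_minors_sum (matrix h)"
  define p where "p x = x ^ 3 - ?t * x\<^sup>2 + ?c * x - 1" for x
  define M where "M = 1 + \<bar>?t\<bar> + \<bar>?c\<bar>"
  have M: "1 \<le> M"
    by (simp add: M_def)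
  have "?t * M\<^sup>2 \<le> \<bar>?t\<bar> * M\<^sup>2"
    by (intro mult_right_mono) auto
  moreover have "- ?c * M \<le> \<bar>?c\<bar> * M\<^sup>2"
  proof -
    have "- ?c * M \<le> \<bar>?c\<bar> * M"
      using M by (intro mult_right_mono) auto
    also have "\<dots> \<le> \<bar>?c\<bar> * M\<^sup>2"
      using M by (intro mult_left_mono) (auto simp: power2_eq_square)
    finally show ?thesis .
  qed
  moreover have "M ^ 3 = M\<^sup>2 + \<bar>?t\<bar> * M\<^sup>2 + \<bar>?c\<bar> * M\<^sup>2"
    by (simp add: M_def power3_eq_cube power2_eq_square algebra_simps)
  moreover have "1 \<le> M\<^sup>2"
    using M by simp
  ultimately have "0 \<le> p M"
    unfolding p_def by linarith
  moreover have "continuous_on {0..M} p"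
    unfolding p_def by (intro continuous_intros)
  moreover have "p 0 \<le> 0"
    by (simp add: p_def)
  ultimately obtain \<mu> where \<mu>: "0 \<le> \<mu>" "p \<mu> = 0"
    using IVT'[of p 0 0 M] M by auto
  have "det (\<mu> *\<^sub>R mat 1 - matrix h) = 0"
    using \<mu> by (simp add: char_poly_3 p_def det)
  then obtain y where y: "y \<noteq> 0" "(\<mu> *\<^sub>R mat 1 - matrix h) *v y = 0"
    using invertible_det_nz invertible_left_inverse matrix_left_invertible_ker by metis
  then have "h y = \<mu> *\<^sub>R y"
    using l by (simp add: matrix_vector_mult_diff_rdistrib scaleR_matrix_vector_assoc[symmetric])
  then have "\<mu> * N y = N y"
    using Nh[of y] \<mu>(1) by (simp add: scale)
  then have "\<mu> = 1"
    using y(1) by (simp add: eq_0_iff)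
  then show ?thesis
    using \<mu>(2) by (simp add: p_def)
qed

text \<open>
  With determinant \<open>1\<close> and middle coefficients of opposite sign, the characteristic polynomial
  \<open>x\<^sup>3 - (tr h) x\<^sup>2 + (tr h) x - 1\<close> factors as \<open>(x - 1) (x\<^sup>2 - (tr h - 1) x + 1)\<close>.
\<close>

lemma quadratic_relation_on_range:
  fixes N :: "real ^ 3 \<Rightarrow> real"
  assumes "minkowski_norm N" "h \<in> linear_isometries N" "det (matrix h) = 1"
  defines "w x \<equiv> h x - x"
  shows "h (h (w x)) = (trace (matrix h) - 1) *\<^sub>R h (w x) - w x"
proof -
  have l: "linear h"
    using assms by (auto simp: linear_isometries_def)
  have "h (h (h x)) = trace (matrix h) *\<^sub>R h (h x) - trace (matrix h) *\<^sub>R h x + x"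
    using cayley_hamilton_3[of "matrix h" x] assms(3)
      principal_minors_sum_eq_trace[OF assms(1-3)] l
    by simp
  then show ?thesis
    by (simp add: w_def linear_diff[OF l] algebra_simps)
qed


section \<open>Orbits on ellipses\<close>

lemma rotation_funpow:
  fixes h :: "'a :: real_vector \<Rightarrow> 'a"
  assumes l: "linear h" and w: "h w = cos \<theta> *\<^sub>R w + sin \<theta> *\<^sub>R v"
    and v: "h v = cos \<theta> *\<^sub>R v - sin \<theta> *\<^sub>R w"
  shows "(h ^^ k) w = cos (real k * \<theta>) *\<^sub>R w + sin (real k * \<theta>) *\<^sub>R v"
proof (induction k)
  case (Suc k)
  have "real (Suc k) * \<theta> = real k * \<theta> + \<theta>"
    by (simp add: algebra_simps)
  then show ?case
    by (simp add: Suc w v linear_add[OF l] linear_scale[OF l] cos_add sin_add algebra_simps)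
qed simp

context minkowski_space
begin

text \<open>
  The orbit \<open>h\<^sup>k x = x + k (h x - x)\<close> of a vector that is moved would be unbounded.
\<close>

lemma unipotent_isometry_fixes:
  assumes h: "h \<in> linear_isometries N" and d: "h (h x - x) = h x - x"
  shows "h x = x"
proof -
  have l: "linear h"
    using h by (simp add: linear_isometries_def)
  let ?d = "h x - x"
  have pow: "(h ^^ k) x = x + real k *\<^sub>R ?d" for k
  proof (induction k)
    case (Suc k)
    have "h (x + real k *\<^sub>R ?d) = h x + real k *\<^sub>R ?d"
      by (simp only: linear_add[OF l] linear_scale[OF l] d)
    then show ?case
      by (simp add: Suc scaleR_left_distrib algebra_simps)
  qed simp
  have b: "real k * N ?d \<le> 2 * N x" for k
  proof -
    have "real k * N ?d = N ((h ^^ k) x - x)"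
      by (simp add: pow scale)
    also have "\<dots> \<le> 2 * N x"
      using triangle_diff[of "(h ^^ k) x" x] linear_isometry_funpow[OF h] by simp
    finally show ?thesis .
  qed
  have "?d = 0"
  proof (rule ccontr)
    assume "?d \<noteq> 0"
    then obtain k where "2 * N x < real k * N ?d"
      using reals_Archimedean3[OF pos] by blast
    then show False
      using b[of k] by simp
  qed
  then show ?thesis
    by simp
qed

text \<open>
  Two cases have to be excluded for \<open>w\<close> in the range of \<open>h - 1\<close>. If \<open>s\<close> exceeded \<open>2\<close>, then
  \<open>h w + h\<inverse> w = s w\<close> would be longer than the triangle inequality permits; if \<open>s\<close> were \<open>2\<close>, then
  \<open>h\<close> would be unipotent. Otherwise \<open>w\<close> and the vector \<open>v\<close> with \<open>sin \<theta> v = h w - cos \<theta> w\<close> are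
  conjugate semi-axes of an ellipse along which \<open>h\<close> rotates.
\<close>

lemma orbit_on_ellipse:
  assumes h: "h \<in> linear_isometries N" and s: "0 < s" and "h x \<noteq> x"
    and quad: "\<And>x. h (h (h x - x)) = s *\<^sub>R h (h x - x) - (h x - x)"
  obtains \<theta> w v where "0 < \<theta>" "\<theta> < pi" "s = 2 * cos \<theta>" "N w = 1"
    "\<And>k. N (cos (real k * \<theta>) *\<^sub>R w + sin (real k * \<theta>) *\<^sub>R v) = 1"
proof -
  have l: "linear h" and Nh: "\<And>x. N (h x) = N x"
    using h by (auto simp: linear_isometries_def)
  define w where "w = (1 / N (h x - x)) *\<^sub>R (h x - x)"
  have w: "N w = 1"
    using \<open>h x \<noteq> x\<close> pos[of "h x - x"] by (simp add: w_def scale)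
  have hhw: "h (h w) = s *\<^sub>R h w - w"
    unfolding w_def linear_scale[OF l] quad by (simp add: algebra_simps)
  have "s = N (h (h w) + w)"
    using s w by (simp add: hhw scale Nh)
  also have "\<dots> \<le> 2"
    using triangle[of "h (h w)" w] by (simp add: Nh w)
  finally have "s \<le> 2" .
  moreover have "s \<noteq> 2"
  proof
    assume 2: "s = 2"
    have "h (h w - w) = h w - w"
      using hhw by (simp add: 2 linear_diff[OF l] scaleR_2)
    from unipotent_isometry_fixes[OF h this] have "h w = w" .
    then have "h (h x - x) = h x - x"
      using \<open>h x \<noteq> x\<close> pos[of "h x - x"] by (simp add: w_def linear_scale[OF l])
    from unipotent_isometry_fixes[OF h this] \<open>h x \<noteq> x\<close> show False
      by simp
  qed
  ultimately have s2: "s < 2"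
    by simp
  define \<theta> where "\<theta> = arccos (s / 2)"
  have \<theta>: "0 < \<theta>" "\<theta> < pi"
    using arccos_lt_bounded[of "s / 2"] s s2 by (auto simp: \<theta>_def)
  have cos: "s = 2 * cos \<theta>"
    using s s2 by (simp add: \<theta>_def cos_arccos)
  have sin: "0 < sin \<theta>"
    using \<theta> by (rule sin_gt_zero)
  define v where "v = (1 / sin \<theta>) *\<^sub>R (h w - cos \<theta> *\<^sub>R w)"
  have sv: "sin \<theta> *\<^sub>R v = h w - cos \<theta> *\<^sub>R w"
    using sin by (simp add: v_def)
  have "sin \<theta> *\<^sub>R h v = h (sin \<theta> *\<^sub>R v)"
    by (simp add: linear_scale[OF l])
  also have "\<dots> = cos \<theta> *\<^sub>R h w - w"
    by (simp add: sv linear_diff[OF l] linear_scale[OF l] hhw cos algebra_simps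
        flip: scaleR_2)
  also have "\<dots> = cos \<theta> *\<^sub>R (sin \<theta> *\<^sub>R v) - (sin \<theta>)\<^sup>2 *\<^sub>R w"
    unfolding sv sin_squared_eq by (simp add: algebra_simps power2_eq_square)
  also have "\<dots> = sin \<theta> *\<^sub>R (cos \<theta> *\<^sub>R v - sin \<theta> *\<^sub>R w)"
    by (simp add: algebra_simps power2_eq_square)
  finally have hv: "h v = cos \<theta> *\<^sub>R v - sin \<theta> *\<^sub>R w"
    using sin by simp
  have hw: "h w = cos \<theta> *\<^sub>R w + sin \<theta> *\<^sub>R v"
    by (simp add: sv)
  have "N (cos (real k * \<theta>) *\<^sub>R w + sin (real k * \<theta>) *\<^sub>R v) = 1" for k
    using linear_isometry_funpow[OF h, of k w] w by (simp add: rotation_funpow[OF l hw hv])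
  then show ?thesis
    using that \<theta> cos w by blast
qed

text \<open>
  The steps are so short that some orbit point has an angle between \<open>\<pi> / 6\<close> and \<open>\<pi> / 2\<close>. There
  the coefficient of \<open>v\<close> is at least \<open>1 / 2\<close>, while the vector and \<open>w\<close> have norm \<open>1\<close>.
\<close>

lemma second_axis_bounded:
  assumes \<theta>: "0 < \<theta>" "\<theta> < 1" and w: "N w = 1"
    and orbit: "\<And>k. N (cos (real k * \<theta>) *\<^sub>R w + sin (real k * \<theta>) *\<^sub>R v) = 1"
  shows "N v \<le> 4"
proof -
  define k where "k = nat \<lceil>pi / 6 / \<theta>\<rceil>"
  have "pi / 6 / \<theta> \<le> real k" "real k < pi / 6 / \<theta> + 1"
    using \<theta> by (simp_all add: k_def ceiling_less_iff) linarith+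
  then have "pi / 6 \<le> real k * \<theta>" "real k * \<theta> \<le> pi / 6 + \<theta>"
    using \<theta> by (simp_all add: field_simps)
  then have k: "pi / 6 \<le> real k * \<theta>" "real k * \<theta> \<le> pi / 2"
    using \<theta> pi_gt3 by linarith+
  let ?c = "cos (real k * \<theta>)" and ?s = "sin (real k * \<theta>)"
  have s: "1 / 2 \<le> ?s"
    using sin_monotone_2pi_le[OF _ k] by (simp add: sin_30)
  have "?s *\<^sub>R v = (?c *\<^sub>R w + ?s *\<^sub>R v) - ?c *\<^sub>R w"
    by simp
  then have "N (?s *\<^sub>R v) \<le> 1 + \<bar>?c\<bar> * 1"
    using triangle_diff[of "?c *\<^sub>R w + ?s *\<^sub>R v" "?c *\<^sub>R w"] orbit[of k] w by (simp add: scale)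
  moreover have "N (?s *\<^sub>R v) = ?s * N v"
    using s by (simp add: scale)
  ultimately have "?s * N v \<le> 2"
    using abs_cos_le_one[of "real k * \<theta>"] by linarith
  moreover have "1 / 2 * N v \<le> ?s * N v"
    using s nonneg by (intro mult_right_mono)
  ultimately show ?thesis
    by simp
qed

text \<open>
  The semi-axes stay in a compact set. At their accumulation point every angle \<open>t\<close> is the limit of
  the multiples \<open>k \<theta>\<close> with \<open>k = \<lfloor>t / \<theta>\<rfloor>\<close>, at which the norm is \<open>1\<close>.
\<close>

lemma ellipse_on_unit_sphere:
  assumes "\<And>\<delta>. 0 < \<delta> \<Longrightarrow> \<exists>\<theta> w v. 0 < \<theta> \<and> \<theta> < \<delta> \<and> N w = 1 \<and>
    (\<forall>k. N (cos (real k * \<theta>) *\<^sub>R w + sin (real k * \<theta>) *\<^sub>R v) = 1)"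
  obtains w v where "\<And>t. 0 \<le> t \<Longrightarrow> N (cos t *\<^sub>R w + sin t *\<^sub>R v) = 1"
proof -
  have "\<forall>n. \<exists>\<theta> w v. 0 < \<theta> \<and> \<theta> < 1 / real (Suc n) \<and> N w = 1 \<and>
      (\<forall>k. N (cos (real k * \<theta>) *\<^sub>R w + sin (real k * \<theta>) *\<^sub>R v) = 1)"
    by (intro allI assms) simp
  then obtain \<theta> w v where \<theta>: "\<And>n. 0 < \<theta> n" "\<And>n. \<theta> n < 1 / real (Suc n)"
    and w: "\<And>n. N (w n) = 1"
    and orbit: "\<And>n k. N (cos (real k * \<theta> n) *\<^sub>R w n + sin (real k * \<theta> n) *\<^sub>R v n) = 1"
    by metis
  have "\<theta> n < 1" for n
    using \<theta>(2)[of n] by (rule less_le_trans) simp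
  then have v: "N (v n) \<le> 4" for n
    using second_axis_bounded \<theta>(1) w orbit by blast
  obtain m where m: "0 < m" "\<And>x. m * norm x \<le> N x"
    using equivalent_to_norm by metis
  have nb: "norm x \<le> 4 / m" if "N x \<le> 4" for x
    using m(1) order_trans[OF m(2) that] by (simp add: field_simps)
  have "\<forall>n. (w n, v n) \<in> cball 0 (4 / m) \<times> cball 0 (4 / m)"
    using nb v w by simp
  moreover have "compact (cball (0 :: real ^ 'n) (4 / m) \<times> cball (0 :: real ^ 'n) (4 / m))"
    by (intro compact_Times compact_cball)
  ultimately obtain l r where r: "strict_mono r" and wv: "(\<lambda>n. (w (r n), v (r n))) \<longlonglongrightarrow> l"
    unfolding compact_def comp_def by meson
  have lim: "(\<lambda>n. w (r n)) \<longlonglongrightarrow> fst l" "(\<lambda>n. v (r n)) \<longlonglongrightarrow> snd l"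
    using tendsto_fst[OF wv] tendsto_snd[OF wv] by simp_all
  have "(\<lambda>n. \<theta> n) \<longlonglongrightarrow> 0"
    by (rule tendsto_sandwich[OF _ _ tendsto_const LIMSEQ_inverse_real_of_nat])
      (use \<theta> in \<open>auto intro!: always_eventually less_imp_le simp: inverse_eq_divide\<close>)
  then have \<theta>r: "(\<lambda>n. \<theta> (r n)) \<longlonglongrightarrow> 0"
    using LIMSEQ_subseq_LIMSEQ[OF _ r] by (auto simp: comp_def)
  have "N (cos t *\<^sub>R fst l + sin t *\<^sub>R snd l) = 1" if "0 \<le> t" for t
  proof -
    define k where "k n = nat \<lfloor>t / \<theta> (r n)\<rfloor>" for n
    have k: "t - \<theta> (r n) \<le> real (k n) * \<theta> (r n)" "real (k n) * \<theta> (r n) \<le> t" for n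
    proof -
      have p: "0 < \<theta> (r n)" by (rule \<theta>)
      then have "real (k n) \<le> t / \<theta> (r n)" "t / \<theta> (r n) \<le> real (k n) + 1"
        using \<open>0 \<le> t\<close> by (simp_all add: k_def)
      then show "t - \<theta> (r n) \<le> real (k n) * \<theta> (r n)" "real (k n) * \<theta> (r n) \<le> t"
        using p by (simp_all add: field_simps)
    qed
    have lower: "(\<lambda>n. t - \<theta> (r n)) \<longlonglongrightarrow> t"
      using tendsto_diff[OF tendsto_const \<theta>r, of t] by simp
    have angle: "(\<lambda>n. real (k n) * \<theta> (r n)) \<longlonglongrightarrow> t"
      by (rule tendsto_sandwich[OF _ _ lower tendsto_const]) (use k in auto)
    have "(\<lambda>n. cos (real (k n) * \<theta> (r n)) *\<^sub>R w (r n) + sin (real (k n) * \<theta> (r n)) *\<^sub>R v (r n))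
        \<longlonglongrightarrow> cos t *\<^sub>R fst l + sin t *\<^sub>R snd l"
      by (intro tendsto_intros angle lim)
    then have "(\<lambda>n. N (cos (real (k n) * \<theta> (r n)) *\<^sub>R w (r n)
          + sin (real (k n) * \<theta> (r n)) *\<^sub>R v (r n)))
        \<longlonglongrightarrow> N (cos t *\<^sub>R fst l + sin t *\<^sub>R snd l)"
      using continuous_on_tendsto_compose[OF continuous[of UNIV]] by auto
    then show ?thesis
      using LIMSEQ_unique[OF _ tendsto_const[of "1::real"]] by (simp add: orbit)
  qed
  then show ?thesis
    by (rule that)
qed

text \<open>
  By homogeneity \<open>N\<close> is the Euclidean norm in the coordinates given by \<open>w\<close> and \<open>v\<close>, which also
  makes the two vectors independent.
\<close>

lemma elliptic_section:
  assumes "\<And>t. 0 \<le> t \<Longrightarrow> N (cos t *\<^sub>R w + sin t *\<^sub>R v) = 1"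
  shows "\<exists>P. two_plane P \<and> ellipse (P \<inter> unit_ball N)"
proof -
  have circle: "N (s *\<^sub>R w + t *\<^sub>R v) = 1" if "s\<^sup>2 + t\<^sup>2 = 1" for s t
    using sincos_total_2pi[OF that] assms by metis
  have N: "N (s *\<^sub>R w + t *\<^sub>R v) = sqrt (s\<^sup>2 + t\<^sup>2)" for s t
  proof (cases "s = 0 \<and> t = 0")
    case False
    define \<rho> where "\<rho> = sqrt (s\<^sup>2 + t\<^sup>2)"
    have \<rho>: "0 < \<rho>" "\<rho>\<^sup>2 = s\<^sup>2 + t\<^sup>2"
      using False by (auto simp: \<rho>_def sum_power2_gt_zero_iff)
    have "(s / \<rho>)\<^sup>2 + (t / \<rho>)\<^sup>2 = (s\<^sup>2 + t\<^sup>2) / \<rho>\<^sup>2"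
      by (simp add: power_divide add_divide_distrib)
    also have "\<dots> = 1"
      using \<rho>(1) by (simp flip: \<rho>(2))
    finally have "N ((s / \<rho>) *\<^sub>R w + (t / \<rho>) *\<^sub>R v) = 1"
      by (rule circle)
    moreover have "s *\<^sub>R w + t *\<^sub>R v = \<rho> *\<^sub>R ((s / \<rho>) *\<^sub>R w + (t / \<rho>) *\<^sub>R v)"
      using \<rho>(1) by (simp add: scaleR_right_distrib)
    ultimately show ?thesis
      using \<rho>(1) by (simp add: scale \<rho>_def)
  qed simp
  have ne: "w \<noteq> v"
    using N[of 1 "- 1"] by auto
  have "w \<noteq> 0" "v \<noteq> 0"
    using N[of 1 0] N[of 0 1] by auto
  moreover have "w \<notin> span {v}"
  proof
    assume "w \<in> span {v}"
    then obtain c where "w = c *\<^sub>R v"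
      by (auto simp: span_singleton)
    then have "sqrt (1\<^sup>2 + (- c)\<^sup>2) = 0"
      using N[of 1 "- c"] by simp
    then show False
      by (simp add: add_nonneg_eq_0_iff)
  qed
  ultimately have ind: "independent {w, v}"
    using ne by (simp add: independent_insert)
  let ?P = "span {w, v}"
  have "dim ?P = 2"
    using dim_eq_card_independent[OF ind] ne by simp
  then have "two_plane ?P"
    by (simp add: two_plane_def subspace_imp_affine aff_dim_subspace)
  moreover have "?P \<inter> unit_ball N = {0 + s *\<^sub>R w + t *\<^sub>R v | s t. s\<^sup>2 + t\<^sup>2 \<le> 1}"
  proof -
    have "?P = {s *\<^sub>R w + t *\<^sub>R v | s t. True}"
      by (auto simp: span_insert span_singleton algebra_simps)
    then show ?thesis
      by (auto simp: unit_ball_def N) blast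
  qed
  ultimately show ?thesis
    using ellipse_iff_affine_disc ne ind by blast
qed

end


section \<open>Finiteness of the linear isometry group\<close>

lemma small_rotation_exists:
  fixes N :: "real ^ 3 \<Rightarrow> real"
  assumes N: "minkowski_norm N" and inf: "infinite (linear_isometries N)" and \<delta>: "0 < \<delta>"
  shows "\<exists>\<theta> w v. 0 < \<theta> \<and> \<theta> < \<delta> \<and> N w = 1 \<and>
    (\<forall>k. N (cos (real k * \<theta>) *\<^sub>R w + sin (real k * \<theta>) *\<^sub>R v) = 1)"
proof -
  interpret minkowski_space N
    using N by unfold_locales
  define \<eta> where "\<eta> = min \<delta> (pi / 2)"
  have \<eta>: "0 < \<eta>" "\<eta> \<le> \<delta>" "\<eta> \<le> pi / 2"
    using \<delta> by (auto simp: \<eta>_def)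
  have c: "0 \<le> cos \<eta>" "cos \<eta> < 1"
    using \<eta> cos_monotone_0_pi[of 0 \<eta>] by (auto intro!: cos_ge_zero)
  define \<epsilon> where "\<epsilon> = 2 * (1 - cos \<eta>) / 3"
  have "0 < \<epsilon>"
    using c by (simp add: \<epsilon>_def)
  then obtain h where h: "h \<in> linear_isometries N" "h \<noteq> id" "det (matrix h) = 1"
    and close: "\<And>i. norm (h (axis i 1) - axis i 1) < \<epsilon>"
    using linear_isometry_near_identity[OF N inf] by metis
  define s where "s = trace (matrix h) - 1"
  (* three diagonal entries, each within \<epsilon> of 1 *)
  have "1 - \<epsilon> < matrix h $ i $ i" for i
  proof -
    have "\<bar>matrix h $ i $ i - 1\<bar> \<le> norm (h (axis i 1) - axis i 1)"
      using component_le_norm_cart[of "h (axis i 1) - axis i 1" i] by (simp add: matrix_def)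
    then show ?thesis
      using close[of i] by linarith
  qed
  from this[of 1] this[of 2] this[of 3] have s: "2 * cos \<eta> < s"
    by (simp add: s_def trace_def sum_3 \<epsilon>_def field_simps)
  then have "0 < s"
    using c by linarith
  obtain x where x: "h x \<noteq> x"
    using h(2) by (auto simp: fun_eq_iff)
  have "h (h (h x - x)) = s *\<^sub>R h (h x - x) - (h x - x)" for x
    unfolding s_def by (rule quadratic_relation_on_range[OF N h(1,3)])
  from orbit_on_ellipse[OF h(1) \<open>0 < s\<close> x this]
  obtain \<theta> w v where \<theta>: "0 < \<theta>" "\<theta> < pi" "s = 2 * cos \<theta>" and "N w = 1"
    "\<And>k. N (cos (real k * \<theta>) *\<^sub>R w + sin (real k * \<theta>) *\<^sub>R v) = 1"
    by blast
  moreover have "\<theta> < \<eta>"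
    using s \<theta> \<eta> cos_mono_less_eq[of \<eta> \<theta>] by auto
  ultimately show ?thesis
    using \<eta>(2) by (meson less_le_trans)
qed

theorem finite_linear_isometries:
  fixes N :: "real ^ 3 \<Rightarrow> real"
  assumes N: "minkowski_norm N" and "\<not> (\<exists>P. two_plane P \<and> ellipse (P \<inter> unit_ball N))"
  shows "finite (linear_isometries N)"
proof (rule ccontr)
  interpret minkowski_space N
    using N by unfold_locales
  assume "infinite (linear_isometries N)"
  then obtain w v where "\<And>t. 0 \<le> t \<Longrightarrow> N (cos t *\<^sub>R w + sin t *\<^sub>R v) = 1"
    using ellipse_on_unit_sphere[OF small_rotation_exists[OF N]] by blast
  then show False
    using elliptic_section assms(2) by blast
qed

theorem theorem12:
  fixes N :: "real ^ 3 \<Rightarrow> real"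
  assumes "minkowski_norm N"
    and "\<not> (\<exists>P. two_plane P \<and> ellipse (P \<inter> unit_ball N))"
  shows "\<exists>H :: (real ^ 3 \<Rightarrow> real ^ 3) set. subgroup H unimodular_group \<and> finite H \<and>
    isometry_group N \<cong>
      semidirect_product (translation_group :: (real ^ 3 \<Rightarrow> real ^ 3) monoid)
        (unimodular_group\<lparr>carrier := H\<rparr>) conj_translation"
  using subgroup_linear_isometries[OF assms(1)] finite_linear_isometries[OF assms]
    isometry_group_iso_semidirect[OF assms(1)]
  by blast

end
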